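(* Let $(X,d,W)$ be a complete convex metric space and let $T,S:X\to X$ be such that $(T,S)$ is an $(a,\alpha,\lambda)$-enriched interpolative Kannan pair, where $a,\lambda\in[0,1)$ and $\alpha\in(0,1)$. Then the common fixed point problem of the pair $(T,S)$ is Ulam-Hyers stable.
   Context: Metric spaces are nonempty. Convex structure: for a metric space $(X,d)$, a continuous function $W:X\times X\times[0,1]\to X$ is a convex structure on $X$ if for all $x,y\in X$ and $\lambda\in[0,1]$, $d(u,W(x,y;\lambda))\le \lambda d(u,x)+(1-\lambda)d(u,y)$ for every $u\in X$. Then $(X,d,W)$ is called a (Takahashi) convex metric space; it is complete if $(X,d)$ is complete. For $a,\lambda\in[0,1)$ and $\alpha\in(0,1)$, a pair $(T,S)$ of mappings $T,S:X\to X$ is an $(a,\alpha,\lambda)$-enriched interpolative Kannan pair if $$d(W(x,Tx;\lambda),W(y,Sy;\lambda))\le a\,[d(x,W(x,Tx;\lambda))]^{\alpha}\,[d(y,W(y,Sy;\lambda))]^{1-\alpha}$$ for all $x,y\in X$. For $\epsilon>0$, a point $w^*\in X$ is an $\epsilon$-solution of the common fixed point problem of $(T,S)$ (with $\lambda$ the parameter of the pair) if $d(w^*,W(w^*,Tw^*;\lambda))\le\epsilon$ and $d(w^*,W(w^*,Sw^*;\lambda))\le\epsilon$. The common fixed point problem of $(T,S)$ is Ulam-Hyers stable if there is a constant $c>0$ such that for every $\epsilon>0$ and every $\epsilon$-solution $w^*\in X$ there exists a common solution $x^*\in X$ (that is, $Tx^*=x^*=Sx^*$) with $d(x^*,w^*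 )\le c\,\epsilon$. *)

theory Defs
  imports "HOL-Analysis.Analysis"
begin

text \<open>
  Convex structure in the sense of Takahashi. The real argument of \<open>W\<close> is only meaningful on
  \<open>{0..1}\<close>; values outside that interval are unconstrained.
\<close>

definition convex_structure :: "('a::metric_space \<Rightarrow> 'a \<Rightarrow> real \<Rightarrow> 'a) \<Rightarrow> bool" where
  "convex_structure W \<longleftrightarrow>
     continuous_on (UNIV \<times> UNIV \<times> {0..1}) (\<lambda>(x, y, t). W x y t) \<and>
     (\<forall>x y. \<forall>t\<in>{0..1}. \<forall>u. dist u (W x y t) \<le> t * dist u x + (1 - t) * dist u y)"

text \<open>
  Intended for \<open>0 < \<alpha> < 1\<close>: both exponents are then positive, so \<open>0 powr _ = 0\<close> is the usual
  convention and the condition ranges over all points, fixed points included.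
\<close>

definition enriched_interpolative_Kannan_pair ::
  "('a::metric_space \<Rightarrow> 'a \<Rightarrow> real \<Rightarrow> 'a) \<Rightarrow> real \<Rightarrow> real \<Rightarrow> real \<Rightarrow> ('a \<Rightarrow> 'a) \<Rightarrow> ('a \<Rightarrow> 'a) \<Rightarrow> bool"
where
  "enriched_interpolative_Kannan_pair W a \<alpha> lam T S \<longleftrightarrow>
     (\<forall>x y. dist (W x (T x) lam) (W y (S y) lam)
        \<le> a * dist x (W x (T x) lam) powr \<alpha> * dist y (W y (S y) lam) powr (1 - \<alpha>))"

definition eps_solution ::
  "('a::metric_space \<Rightarrow> 'a \<Rightarrow> real \<Rightarrow> 'a) \<Rightarrow> real \<Rightarrow> ('a \<Rightarrow> 'a) \<Rightarrow> ('a \<Rightarrow> 'a) \<Rightarrow> real \<Rightarrow> 'a \<Rightarrow> bool"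
where
  "eps_solution W lam T S \<epsilon> w \<longleftrightarrow>
     dist w (W w (T w) lam) \<le> \<epsilon> \<and> dist w (W w (S w) lam) \<le> \<epsilon>"

definition Ulam_Hyers_stable ::
  "('a::metric_space \<Rightarrow> 'a \<Rightarrow> real \<Rightarrow> 'a) \<Rightarrow> real \<Rightarrow> ('a \<Rightarrow> 'a) \<Rightarrow> ('a \<Rightarrow> 'a) \<Rightarrow> bool"
where
  "Ulam_Hyers_stable W lam T S \<longleftrightarrow>
     (\<exists>c>0. \<forall>\<epsilon>>0. \<forall>w. eps_solution W lam T S \<epsilon> w \<longrightarrow>
        (\<exists>x. T x = x \<and> S x = x \<and> dist x w \<le> c * \<epsilon>))"

end

theory Submission
  imports Defs
begin

text \<open>
  Write \<open>F x = W x (T x) lam\<close> and \<open>G x = W x (S x) lam\<close> for the averaged maps. Because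
  \<open>lam < 1\<close>, averaging creates no new fixed points, so the problem is about common fixed points of
  \<open>F\<close> and \<open>G\<close>.

  A weighted geometric mean is at most the maximum, so the interpolative condition implies
  \<open>dist (F x) (G y) \<le> a * max (dist x (F x)) (dist y (G y))\<close>. It
  bounds the distance between an image under \<open>F\<close> and one under \<open>G\<close> by the displacements of the
  two arguments alone, not by the distance between the arguments.
  Under alternate application of \<open>F\<close> and \<open>G\<close> the displacements shrink geometrically, hence the
  orbit is Cauchy, and its limit is a common fixed point \<open>z\<close> (lemma \<open>common_fixed_point\<close>).

  Stability uses the same condition once more: if \<open>w\<close> is displaced by at most \<open>\<epsilon>\<close>, then, since
  \<open>z = G z\<close> is not displaced at all, \<open>dist (F w) z \<le> a * \<epsilon>\<close>, so \<open>w\<close> is within \<open>(1 + a) * \<epsilon>\<close>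
  of \<open>z\<close>.
\<close>

text \<open>
  Seen from \<open>y\<close> itself, convexity puts the average within \<open>lam * dist y x\<close> of \<open>y\<close>, which is
  too close for it to be \<open>x\<close> when \<open>y \<noteq> x\<close>.
\<close>

lemma convex_structure_average_eq_iff:
  assumes W: "convex_structure W" and lam: "0 \<le> lam" "lam < 1"
  shows "W x y lam = x \<longleftrightarrow> y = x"
proof
  have conv: "dist u (W x y lam) \<le> lam * dist u x + (1 - lam) * dist u y" for u
    using W lam by (auto simp: convex_structure_def)
  show "y = x" if "W x y lam = x"
  proof (rule ccontr)
    assume "y \<noteq> x"
    then have "lam * dist y x < 1 * dist y x"
      using lam by (intro mult_strict_right_mono) auto
    with conv[of y] that show False by simp
  qed
  show "W x y lam = x" if "y = x"
    using conv[of x] that by simp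
qed

lemma geometric_mean_le_max:
  fixes p q \<alpha> :: real
  assumes "0 \<le> p" "0 \<le> q" "0 \<le> \<alpha>" "\<alpha> \<le> 1"
  shows "p powr \<alpha> * q powr (1 - \<alpha>) \<le> max p q"
proof -
  have "p powr \<alpha> * q powr (1 - \<alpha>) \<le> max p q powr \<alpha> * max p q powr (1 - \<alpha>)"
    using assms by (intro mult_mono powr_mono2) auto
  also have "\<dots> = max p q"
    using assms by (simp flip: powr_add)
  finally show ?thesis .
qed

text \<open>
  Along an orbit the new displacement \<open>q = dist (F x) (G (F x))\<close> occurs on both sides of the
  condition. The maximum cannot be attained by \<open>q\<close> unless \<open>q = 0\<close>, since \<open>a < 1\<close>.
\<close>

lemma displacement_contracts:
  fixes F G :: "'a::metric_space \<Rightarrow> 'a" and a :: real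
  assumes a: "0 \<le> a" "a < 1"
    and FG: "\<And>x y. dist (F x) (G y) \<le> a * max (dist x (F x)) (dist y (G y))"
  shows "dist (F x) (G (F x)) \<le> a * dist x (F x)"
proof -
  let ?p = "dist x (F x)" and ?q = "dist (F x) (G (F x))"
  have le: "?q \<le> a * max ?p ?q"
    using FG .
  show ?thesis
  proof (cases "?q \<le> ?p")
    case True
    then show ?thesis using le by (simp add: max_absorb1)
  next
    case False
    then have "0 < ?q"
      using zero_le_dist[of x "F x"] by linarith
    then have "a * ?q < 1 * ?q"
      using a(2) by (intro mult_strict_right_mono)
    moreover have "max ?p ?q = ?q"
      using False by linarith
    ultimately have False
      using le by simp
    then show ?thesis ..
  qed
qed

text \<open>
  Sampling the alternating orbit at every second step, as iterates of \<open>G \<circ> F\<close>, avoids a case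
  distinction on parity. The Cauchy property comes from applying the condition to two distant terms
  at once, since \<open>F (X m)\<close> and \<open>X (Suc n) = G (F (X n))\<close> are images under \<open>F\<close> and \<open>G\<close>,
  instead of summing consecutive distances.
\<close>

lemma common_fixed_point:
  fixes F G :: "'a::complete_space \<Rightarrow> 'a" and a :: real
  assumes a: "0 \<le> a" "a < 1"
    and FG: "\<And>x y. dist (F x) (G y) \<le> a * max (dist x (F x)) (dist y (G y))"
  shows "\<exists>z. F z = z \<and> G z = z"
proof -
  have GF: "dist (G x) (F y) \<le> a * max (dist x (G x)) (dist y (F y))" for x y
    using FG[of y x] by (simp add: dist_commute max.commute)
  note F_step = displacement_contracts[OF a FG] and G_step = displacement_contracts[OF a GF]
  define X where "X n = ((\<lambda>x. G (F x)) ^^ n) undefined" for n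
  have X_Suc: "X (Suc n) = G (F (X n))" for n
    by (simp add: X_def)
  define \<delta> where "\<delta> n = dist (X n) (F (X n))" for n
  have mid: "dist (F (X n)) (G (F (X n))) \<le> \<delta> n" for n
  proof -
    have "a * \<delta> n \<le> \<delta> n"
      using a by (simp add: mult_left_le_one_le \<delta>_def)
    with F_step[of "X n"] show ?thesis by (simp add: \<delta>_def)
  qed
  have \<delta>_Suc: "\<delta> (Suc n) \<le> a * \<delta> n" for n
  proof -
    have "\<delta> (Suc n) \<le> a * dist (F (X n)) (G (F (X n)))"
      using G_step[of "F (X n)"] by (simp add: \<delta>_def X_Suc)
    also have "\<dots> \<le> a * \<delta> n"
      using a mid by (intro mult_left_mono)
    finally show ?thesis .
  qed
  have \<delta>_le: "\<delta> n \<le> a ^ n * \<delta> 0" for n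
  proof (induction n)
    case (Suc n)
    have "\<delta> (Suc n) \<le> a * (a ^ n * \<delta> 0)"
      using \<delta>_Suc[of n] mult_left_mono[OF Suc a(1)] by linarith
    then show ?case by (simp add: mult.assoc)
  qed simp
  have "(\<lambda>n. a ^ n * \<delta> 0) \<longlonglongrightarrow> 0"
    using a by (intro tendsto_mult_left_zero LIMSEQ_power_zero) simp
  then have \<delta>_lim: "\<delta> \<longlonglongrightarrow> 0"
    by (rule tendsto_sandwich[OF _ _ tendsto_const, rotated 2]) (auto simp: \<delta>_le, simp add: \<delta>_def)
  have X_dist: "dist (X m) (X (Suc n)) \<le> \<delta> m + max (\<delta> m) (\<delta> n)" for m n
  proof -
    let ?M = "max (\<delta> m) (dist (F (X n)) (G (F (X n))))"
    have "dist (F (X m)) (X (Suc n)) \<le> a * ?M"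
      using FG[of "X m" "F (X n)"] by (simp add: X_Suc \<delta>_def)
    also have "\<dots> \<le> ?M"
      using a by (intro mult_left_le_one_le) (auto simp: \<delta>_def le_max_iff_disj)
    also have "\<dots> \<le> max (\<delta> m) (\<delta> n)"
      using mid by (intro max.mono) auto
    finally show ?thesis
      using dist_triangle[of "X m" "X (Suc n)" "F (X m)"] by (simp add: \<delta>_def)
  qed
  have "Cauchy X"
  proof (rule metric_CauchyI)
    fix e :: real
    assume "0 < e"
    then obtain N where N: "\<And>n. n \<ge> N \<Longrightarrow> \<delta> n < e / 2"
      using order_tendstoD(2)[OF \<delta>_lim, of "e / 2"] by (auto simp: eventually_sequentially)
    have "dist (X m) (X n) < e" if mn: "m \<ge> Suc N" "n \<ge> Suc N" for m n
    proof -
      obtain k where k: "n = Suc k" "k \<ge> N"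
        using mn(2) by (cases n) auto
      have "\<delta> m < e / 2" "\<delta> k < e / 2"
        using N mn(1) k(2) by auto
      then show ?thesis
        using X_dist[of m k] k(1) by (simp add: max_def split: if_splits)
    qed
    then show "\<exists>M. \<forall>m\<ge>M. \<forall>n\<ge>M. dist (X m) (X n) < e" by blast
  qed
  then have "convergent X"
    by (rule Cauchy_convergent)
  then obtain z where z: "X \<longlonglongrightarrow> z"
    unfolding convergent_def by (elim exE)
  have FX: "(\<lambda>n. F (X n)) \<longlonglongrightarrow> z"
  proof (rule metric_tendsto_imp_tendsto)
    show "(\<lambda>n. \<delta> n + dist (X n) z) \<longlonglongrightarrow> 0"
      using tendsto_add[OF \<delta>_lim iffD1[OF tendsto_dist_iff z]] by simp
    have "dist (F (X n)) z \<le> dist (\<delta> n + dist (X n) z) 0" for n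
      using dist_triangle3[of "F (X n)" z "X n"] by (simp add: \<delta>_def)
    then show "\<forall>\<^sub>F n in sequentially. dist (F (X n)) z \<le> dist (\<delta> n + dist (X n) z) 0"
      by simp
  qed
  have fixed: "x = y" if "dist x y \<le> a * dist x y" for x y :: 'a
  proof (rule ccontr)
    assume "x \<noteq> y"
    then have "a * dist x y < 1 * dist x y"
      using a by (intro mult_strict_right_mono) auto
    with that show False by simp
  qed
  \<comment> \<open>\<open>F\<close> and \<open>G\<close> may be discontinuous at \<open>z\<close>; the limit is taken in the condition for the pair
      \<open>X n\<close>, \<open>z\<close>, whose right-hand side depends on \<open>n\<close> only through \<open>\<delta> n\<close>.\<close>
  have "dist z (G z) \<le> a * max 0 (dist z (G z))"
  proof (rule tendsto_le)
    show "(\<lambda>n. dist (F (X n)) (G z)) \<longlonglongrightarrow> dist z (G z)"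
      by (intro tendsto_intros FX)
    show "(\<lambda>n. a * max (\<delta> n) (dist z (G z))) \<longlonglongrightarrow> a * max 0 (dist z (G z))"
      by (intro tendsto_intros \<delta>_lim)
    show "\<forall>\<^sub>F n in sequentially. dist (F (X n)) (G z) \<le> a * max (\<delta> n) (dist z (G z))"
      using FG by (simp add: \<delta>_def)
  qed simp
  then have Gz: "G z = z"
    using fixed[of z "G z"] by simp
  have "dist z (F z) \<le> a * dist z (F z)"
    using FG[of z z] Gz by (simp add: dist_commute)
  then have "F z = z"
    using fixed[of z "F z"] by simp
  with Gz show ?thesis by blast
qed

theorem theorem3p3p2:
  fixes W :: "'a::complete_space \<Rightarrow> 'a \<Rightarrow> real \<Rightarrow> 'a"
    and T S :: "'a \<Rightarrow> 'a"
    and a \<alpha> lam :: real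
  assumes "convex_structure W"
    and "0 \<le> a" "a < 1"
    and "0 \<le> lam" "lam < 1"
    and "0 < \<alpha>" "\<alpha> < 1"
    and "enriched_interpolative_Kannan_pair W a \<alpha> lam T S"
  shows "Ulam_Hyers_stable W lam T S"
proof -
  define F G where "F x = W x (T x) lam" and "G x = W x (S x) lam" for x
  have FG: "dist (F x) (G y) \<le> a * max (dist x (F x)) (dist y (G y))" for x y
  proof -
    have "dist (F x) (G y) \<le> a * (dist x (F x) powr \<alpha> * dist y (G y) powr (1 - \<alpha>))"
      using assms(8)
      by (simp add: enriched_interpolative_Kannan_pair_def F_def G_def mult.assoc)
    also have "\<dots> \<le> a * max (dist x (F x)) (dist y (G y))"
      using assms by (intro mult_left_mono geometric_mean_le_max) auto
    finally show ?thesis .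
  qed
  obtain z where z: "F z = z" "G z = z"
    using common_fixed_point[OF assms(2,3) FG] by blast
  have TS: "T z = z" "S z = z"
    using z convex_structure_average_eq_iff[OF assms(1,4,5)] by (auto simp: F_def G_def)
  have "dist z w \<le> (1 + a) * \<epsilon>" if "eps_solution W lam T S \<epsilon> w" for \<epsilon> w
  proof -
    have w: "dist w (F w) \<le> \<epsilon>"
      using that by (simp add: eps_solution_def F_def)
    have "dist (F w) z \<le> a * dist w (F w)"
      using FG[of w z] z by simp
    also have "\<dots> \<le> a * \<epsilon>"
      using w assms(2) by (rule mult_left_mono)
    finally show ?thesis
      using w dist_triangle[of w z "F w"] by (simp add: dist_commute algebra_simps)
  qed
  moreover have "0 < 1 + a"
    using assms(2) by simp
  ultimately show ?thesis
    unfolding Ulam_Hyers_stable_def using TS by blast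
qed

end
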